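(* (a) There are exactly 43 trapezoidal factors of the Thue-Morse sequence. The longest is of length $8$. (b) There are exactly 185 trapezoidal factors of the Rudin-Shapiro sequence. The longest is of length $12$. (c) There are exactly 57 trapezoidal factors of the ordinary paperfolding sequence. The longest is of length $8$. (d) There are exactly 77 trapezoidal factors of the period-doubling sequence. The longest is of length $15$. (e) Every factor of the Fibonacci word is trapezoidal.
   Context: A word $x$ is trapezoidal if, for each $n\ge 0$, it has at most $n+1$ distinct factors of length $n$. Factors are finite contiguous blocks, counted as distinct words; the empty word is a factor and is included in the counts. Sequences: - Thue-Morse: the fixed point starting with $0$ of the morphism $0\to01$, $1\to10$. - Rudin-Shapiro ($00010010\cdots$): the image under the coding $n\mapsto\lfloor n/2\rfloor$ of the fixed point starting with $0$ of $0\to01$, $1\to02$, $2\to31$, $3\to32$. - Ordinary paperfolding ($00100110\cdots$): $p_{2n+1}=p_n$, $p_{4n}=0$, $p_{4n+2}=1$ for all $n\ge0$. - Period-doubling ($10111010\cdots$): the fixed point starting with $1$ of $1\to10$, $0\to11$. - Fibonacci ($01001010\cdots$): the fixed point starting with $0$ of $0\to01$, $1\to0$. *)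

theory Defs
  imports "HOL-Library.Stream" "HOL-Library.Sublist"
begin

section \<open>Factors and trapezoidal words\<close>

definition trapezoidal :: "'a list \<Rightarrow> bool" where
  "trapezoidal x \<longleftrightarrow> (\<forall>n. card {u. sublist u x \<and> length u = n} \<le> n + 1)"

definition factors :: "'a stream \<Rightarrow> 'a list set" where
  "factors s = {stake n (sdrop i s) | i n. True}"

definition trapezoidal_factors :: "'a stream \<Rightarrow> 'a list set" where
  "trapezoidal_factors s = {x \<in> factors s. trapezoidal x}"


section \<open>Fixed points of morphisms\<close>

text \<open>A morphism is given by its images of letters. Only non-erasing morphisms are used:
  \<^const>\<open>flat\<close> concatenates a stream of nonempty lists.\<close>

definition fixed_point_from :: "('a \<Rightarrow> 'a list) \<Rightarrow> 'a \<Rightarrow> 'a stream" where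
  "fixed_point_from h a = (THE s. shd s = a \<and> flat (smap h s) = s)"

lemma flat_smap_shift:
  assumes "\<And>x. h x \<noteq> []"
  shows "flat (smap h (xs @- s)) = concat (map h xs) @- flat (smap h s)"
proof (induction xs)
  case (Cons x xs)
  then show ?case using assms by (subst flat_unfold) auto
qed simp

theorem ex1_fixed_point:
  fixes h :: "'a \<Rightarrow> 'a list"
  assumes nonerasing: "\<And>x. h x \<noteq> []" and ha: "h a = a # v" and v: "v \<noteq> []"
  shows "\<exists>!s. shd s = a \<and> flat (smap h s) = s"
proof -
  define H where "H u = concat (map h u)" for u
  define w where "w n = (H ^^ n) [a]" for n
  have H_append: "H (x @ y) = H x @ H y" for x y by (simp add: H_def)
  have Hn_append: "(H ^^ n) (x @ y) = (H ^^ n) x @ (H ^^ n) y" for n x y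
    by (induction n) (auto simp: H_append)
  have H_ne: "H x \<noteq> []" if "x \<noteq> []" for x
    using that nonerasing by (cases x) (auto simp: H_def)
  have Hn_ne: "(H ^^ n) v \<noteq> []" for n
    by (induction n) (auto simp: v H_ne)
  have w_Suc: "w (Suc n) = w n @ (H ^^ n) v" for n
  proof -
    have "w (Suc n) = (H ^^ n) (H [a])" by (simp add: w_def funpow_swap1)
    also have "H [a] = [a] @ v" by (simp add: H_def ha)
    finally show ?thesis by (simp only: Hn_append w_def)
  qed
  have w_H: "w (Suc n) = H (w n)" for n by (simp add: w_def)
  have len: "n < length (w n)" for n
  proof (induction n)
    case 0 show ?case by (simp add: w_def)
  next
    case (Suc n)
    have "0 < length ((H ^^ n) v)" using Hn_ne by simp
    with Suc show ?case unfolding w_Suc length_append by linarith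
  qed
  have w_prefix: "\<exists>z. w n = w m @ z" if "m \<le> n" for m n
    using that by (induction n rule: dec_induct) (auto simp: w_Suc)
  have w_nth: "w n ! i = w m ! i" if "i < length (w n)" "i < length (w m)" for i m n
    using w_prefix[of m n] w_prefix[of n m] that nat_le_linear[of m n]
    by (auto simp: nth_append)
  have eqI: "s = t" if "\<And>i. s !! i = t !! i" for s t :: "'a stream"
    using that smap_alt[of id s t] by (simp add: stream.map_id)
  define s where "s = smap (\<lambda>i. w i ! i) nats"
  have s_nth: "s !! i = w i ! i" for i by (simp add: s_def)
  have "stake (length (w n)) s = w n" for n
    proof (rule nth_equalityI)
    fix i assume "i < length (stake (length (w n)) s)"
    then show "stake (length (w n)) s ! i = w n ! i"
      using w_nth[of i i n] len[of i] by (simp add: s_nth)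
  qed simp
  then have s_shift: "s = w n @- sdrop (length (w n)) s" for n
    by (metis stake_sdrop)
  show ?thesis
  proof (rule ex1I[of _ s], intro conjI)
    show "shd s = a" using s_nth[of 0] by (simp add: w_def)
    show "flat (smap h s) = s"
    proof (rule eqI)
      fix i
      have "flat (smap h s) = flat (smap h (w i @- sdrop (length (w i)) s))"
        using s_shift[of i] by simp
      also have "\<dots> = w (Suc i) @- flat (smap h (sdrop (length (w i)) s))"
        by (subst flat_smap_shift[OF nonerasing]) (simp add: w_H H_def)
      finally have *: "flat (smap h s) = w (Suc i) @- flat (smap h (sdrop (length (w i)) s))" .
      have "i < length (w (Suc i))" using len[of "Suc i"] by simp
      then show "flat (smap h s) !! i = s !! i"
        by (subst *) (simp add: s_nth w_nth[of i "Suc i" i] len)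
    qed
  next
    fix t assume t: "shd t = a \<and> flat (smap h t) = t"
    have t_shift: "\<exists>r. t = w n @- r" for n
    proof (induction n)
      case 0
      show ?case using t by (intro exI[of _ "stl t"]) (cases t, simp add: w_def)
    next
      case (Suc n)
      then obtain r where "t = w n @- r" by blast
      then have "flat (smap h t) = w (Suc n) @- flat (smap h r)"
        by (simp add: flat_smap_shift[OF nonerasing] w_H H_def del: smap_shift)
      then show ?case using t by metis
    qed
    show "t = s"
    proof (rule eqI)
      fix i
      show "t !! i = s !! i" using t_shift[of i] len[of i] by (auto simp: s_nth)
    qed
  qed
qed

corollary fixed_point_from:
  assumes "\<And>x. h x \<noteq> []" and "h a = a # v" and "v \<noteq> []"
  shows "shd (fixed_point_from h a) = a"
    and "flat (smap h (fixed_point_from h a)) = fixed_point_from h a"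
  using theI'[OF ex1_fixed_point[of h a v, OF assms]] unfolding fixed_point_from_def by auto


section \<open>The sequences\<close>

text \<open>The letters are natural numbers. A letter outside the alphabet of a morphism is mapped to
  itself; no such letter occurs in the fixed points considered.\<close>

definition thue_morse_morphism :: "nat \<Rightarrow> nat list" where
  "thue_morse_morphism c =
     (if c = 0 then [0, 1] else if c = 1 then [1, 0] else [c])"

definition thue_morse :: "nat stream" where
  "thue_morse = fixed_point_from thue_morse_morphism 0"

definition rudin_shapiro_morphism :: "nat \<Rightarrow> nat list" where
  "rudin_shapiro_morphism c =
     (if c = 0 then [0, 1] else if c = 1 then [0, 2]
      else if c = 2 then [3, 1] else if c = 3 then [3, 2] else [c])"

definition rudin_shapiro :: "nat stream" where
  "rudin_shapiro = smap (\<lambda>c. c div 2) (fixed_point_from rudin_shapiro_morphism 0)"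

function paperfolding_term :: "nat \<Rightarrow> nat" where
  "paperfolding_term (2 * n + 1) = paperfolding_term n"
| "paperfolding_term (4 * n) = 0"
| "paperfolding_term (4 * n + 2) = 1"
proof -
  fix P :: bool and x :: nat
  assume 1: "\<And>n. x = 2 * n + 1 \<Longrightarrow> P" and 2: "\<And>n. x = 4 * n \<Longrightarrow> P"
    and 3: "\<And>n. x = 4 * n + 2 \<Longrightarrow> P"
  have "x = 2 * (x div 2) + 1 \<or> x = 4 * (x div 4) \<or> x = 4 * (x div 4) + 2" by presburger
  then show P using 1 2 3 by blast
next
  show "\<And>n m :: nat. 2 * n + 1 = 4 * m \<Longrightarrow> paperfolding_term_sumC n = 0"
    and "\<And>n m :: nat. 2 * n + 1 = 4 * m + 2 \<Longrightarrow> paperfolding_term_sumC n = 1"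
    and "\<And>n m :: nat. 4 * n = 4 * m + 2 \<Longrightarrow> (0 :: nat) = 1"
    by presburger+
qed simp_all
termination by (relation "measure id") auto

definition paperfolding :: "nat stream" where
  "paperfolding = smap paperfolding_term nats"

definition period_doubling_morphism :: "nat \<Rightarrow> nat list" where
  "period_doubling_morphism c =
     (if c = 1 then [1, 0] else if c = 0 then [1, 1] else [c])"

definition period_doubling :: "nat stream" where
  "period_doubling = fixed_point_from period_doubling_morphism 1"

definition fibonacci_morphism :: "nat \<Rightarrow> nat list" where
  "fibonacci_morphism c =
     (if c = 0 then [0, 1] else if c = 1 then [0] else [c])"

definition fibonacci_word :: "nat stream" where
  "fibonacci_word = fixed_point_from fibonacci_morphism 0"

lemma ex1_fixed_points:
  "\<exists>!s. shd s = 0 \<and> flat (smap thue_morse_morphism s) = s"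
  "\<exists>!s. shd s = 0 \<and> flat (smap rudin_shapiro_morphism s) = s"
  "\<exists>!s. shd s = 1 \<and> flat (smap period_doubling_morphism s) = s"
  "\<exists>!s. shd s = 0 \<and> flat (smap fibonacci_morphism s) = s"
proof -
  show "\<exists>!s. shd s = 0 \<and> flat (smap thue_morse_morphism s) = s"
    by (rule ex1_fixed_point[where v = "[1]"]) (auto simp: thue_morse_morphism_def)
  show "\<exists>!s. shd s = 0 \<and> flat (smap rudin_shapiro_morphism s) = s"
    by (rule ex1_fixed_point[where v = "[1]"]) (auto simp: rudin_shapiro_morphism_def)
  show "\<exists>!s. shd s = 1 \<and> flat (smap period_doubling_morphism s) = s"
    by (rule ex1_fixed_point[where v = "[0]"]) (auto simp: period_doubling_morphism_def)
  show "\<exists>!s. shd s = 0 \<and> flat (smap fibonacci_morphism s) = s"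
    by (rule ex1_fixed_point[where v = "[1]"]) (auto simp: fibonacci_morphism_def)
qed

end

(* The sequences in (a)-(d) are codings of sequences t generated by a 2-uniform morphism h. A factor
   of t of length at most 2^k + 1 is contained in h^k(p) for some two-letter factor p of t, and the
   set of two-letter factors is the orbit of the first one under h. Trapezoidality passes to
   factors, so the trapezoidal factors of each length are counted until some length has none.
   A factor of the Fibonacci word that can be extended to the left by both letters is a prefix; hence
   the complexity grows by at most 1 at each length, and it is at most n + 1. *)
theory Submission
  imports Defs
begin

section \<open>Trapezoidal words and factors\<close>

text \<open>Executable enumeration with repetitions. On \<open>[]\<close> the empty word is the only
  window, which matters for \<open>n = 0\<close> alone.\<close>

fun windows :: "nat \<Rightarrow> 'a list \<Rightarrow> 'a list list" where
  "windows n [] = (if n = 0 then [[]] else [])"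
| "windows n (a # x) = (if n \<le> Suc (length x) then take n (a # x) # windows n x else [])"

lemma set_windows: "set (windows n x) = {u. sublist u x \<and> length u = n}"
proof (induction x)
  case (Cons a x)
  show ?case
  proof (cases "n \<le> Suc (length x)")
    case True
    have "{u. sublist u (a # x) \<and> length u = n} =
        {u. prefix u (a # x) \<and> length u = n} \<union> {u. sublist u x \<and> length u = n}"
      by (auto simp: sublist_Cons_right)
    moreover have "{u. prefix u (a # x) \<and> length u = n} = {take n (a # x)}"
      using True by (auto simp: take_is_prefix min_def simp del: take_Suc_Cons prefix_Cons)
        (metis append_eq_conv_conj prefix_def)
    ultimately show ?thesis using True Cons by simp
  next
    case False
    then have "{u. sublist u (a # x) \<and> length u = n} = {}"
      using sublist_length_le by fastforce
    with False show ?thesis by simp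
  qed
qed auto

text \<open>From length \<open>length x\<close> on there is at most one factor, \<open>x\<close>
  itself, so a finite check suffices; this lets \<open>code_simp\<close> decide
  trapezoidality.\<close>

lemma trapezoidal_code [code]:
  "trapezoidal x \<longleftrightarrow> list_all (\<lambda>n. length (remdups (windows n x)) \<le> n + 1) [0..<length x]"
proof -
  have eq: "card {u. sublist u x \<and> length u = n} = length (remdups (windows n x))" for n
    by (simp add: set_windows [symmetric] length_remdups_card_conv)
  have "card {u. sublist u x \<and> length u = n} \<le> n + 1" if "n \<ge> length x" for n
  proof -
    have "{u. sublist u x \<and> length u = n} \<subseteq> {x}"
      using that sublist_length_le by (fastforce simp: sublist_def)
    from card_mono[OF _ this] show ?thesis by simp
  qed
  then have "trapezoidal x \<longleftrightarrow> (\<forall>n<length x. card {u. sublist u x \<and> length u = n} \<le> n + 1)"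
    unfolding trapezoidal_def using linorder_not_less by blast
  then show ?thesis unfolding eq list_all_iff by (simp add: Ball_def)
qed

lemma finite_sublists_length: "finite {u. sublist u x \<and> length u = n}"
  unfolding set_windows [symmetric] by simp

lemma trapezoidal_sublist:
  assumes "trapezoidal x" "sublist y x"
  shows "trapezoidal y"
  unfolding trapezoidal_def
proof
  fix n
  have "card {u. sublist u y \<and> length u = n} \<le> card {u. sublist u x \<and> length u = n}"
    using assms(2) by (intro card_mono finite_sublists_length) (auto intro: sublist_order.order_trans)
  also have "\<dots> \<le> n + 1" using assms(1) by (simp add: trapezoidal_def)
  finally show "card {u. sublist u y \<and> length u = n} \<le> n + 1" .
qed

section \<open>Factors of streams and counting by length\<close>

lemma factors_iff_shift: "u \<in> factors s \<longleftrightarrow> (\<exists>x y. s = x @- u @- y)"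
proof
  assume "u \<in> factors s"
  then obtain i n where "u = stake n (sdrop i s)" by (auto simp: factors_def)
  then have "s = stake i s @- u @- sdrop n (sdrop i s)" by (simp only: stake_sdrop)
  then show "\<exists>x y. s = x @- u @- y" by blast
next
  assume "\<exists>x y. s = x @- u @- y"
  then obtain x y where "s = x @- u @- y" by blast
  then have "u = stake (length u) (sdrop (length x) s)" by (simp add: stake_shift sdrop_shift)
  then show "u \<in> factors s" unfolding factors_def by blast
qed

lemma factors_sublist:
  assumes "x \<in> factors s" "sublist u x"
  shows "u \<in> factors s"
  using assms unfolding factors_iff_shift sublist_def by (metis shift_append)

lemma factors_length: "{x \<in> factors s. length x = n} = range (\<lambda>i. stake n (sdrop i s))"
  by (auto simp: factors_def)

text \<open>A trapezoidal factor of length at least \<open>L\<close> would have a trapezoidal prefix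
  of length \<open>L\<close>, and the final 0 excludes these. Entry \<open>n\<close> of
  \<open>ns\<close> belongs to length \<open>n\<close>, so the greatest length is the last index,
  attained because \<open>last ns\<close> is nonzero.\<close>

lemma card_Max_trapezoidal_factors:
  assumes counts: "map (\<lambda>n. card {x \<in> trapezoidal_factors s. length x = n}) [0..<Suc L] = ns @ [0]"
    and ns: "ns \<noteq> []" "last ns \<noteq> 0"
    and fin: "\<And>n. n \<le> L \<Longrightarrow> finite {x \<in> factors s. length x = n}"
  shows "card (trapezoidal_factors s) = sum_list ns"
    and "Max (length ` trapezoidal_factors s) = length ns - 1"
proof -
  let ?T = "\<lambda>n. {x \<in> trapezoidal_factors s. length x = n}"
  have L: "length ns = L" and ns_eq: "ns = map (\<lambda>n. card (?T n)) [0..<L]" and card0: "card (?T L) = 0"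
    using counts by (auto dest: arg_cong[where f = length])
  have finT: "finite (?T n)" if "n \<le> L" for n
    using fin[OF that] by (rule finite_subset[rotated]) (auto simp: trapezoidal_factors_def)
  have less: "length x < L" if "x \<in> trapezoidal_factors s" for x
  proof (rule ccontr)
    assume "\<not> length x < L"
    moreover have "take L x \<in> trapezoidal_factors s"
      using that trapezoidal_sublist[of x "take L x"] factors_sublist[of x s "take L x"]
      by (auto simp: trapezoidal_factors_def)
    ultimately have "take L x \<in> ?T L" by simp
    \<comment> \<open>Finiteness is essential here, as \<open>card\<close> is also 0 on infinite
      sets.\<close>
    then show False using card0 finT[of L] by auto
  qed
  have un: "trapezoidal_factors s = (\<Union>n\<in>{..<L}. ?T n)" using less by auto
  have "card (trapezoidal_factors s) = (\<Sum>n<L. card (?T n))"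
    by (subst un, rule card_UN_disjoint) (auto simp: finT)
  also have "\<dots> = sum_list ns"
    by (simp add: ns_eq interv_sum_list_conv_sum_set_nat lessThan_atLeast0)
  finally show "card (trapezoidal_factors s) = sum_list ns" .
  have "L > 0" using ns L by auto
  then have "last ns = card (?T (L - 1))" using ns L by (simp add: last_conv_nth ns_eq)
  with ns have "?T (L - 1) \<noteq> {}" by (metis card.empty)
  then obtain x where x: "x \<in> ?T (L - 1)" by blast
  have "finite (trapezoidal_factors s)" by (subst un) (auto simp: finT)
  then show "Max (length ` trapezoidal_factors s) = length ns - 1"
    using x less L by (intro Max_eqI) (fastforce intro: rev_image_eqI)+
qed


section \<open>Morphisms\<close>

definition morph :: "('a \<Rightarrow> 'b list) \<Rightarrow> 'a list \<Rightarrow> 'b list" where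
  "morph h x = concat (map h x)"

lemma morph_simps [simp]:
  "morph h [] = []" "morph h (a # x) = h a @ morph h x" "morph h (x @ y) = morph h x @ morph h y"
  by (simp_all add: morph_def)

lemma flat_smap_morph:
  assumes "\<And>c. h c \<noteq> []"
  shows "flat (smap h (x @- s)) = morph h x @- flat (smap h s)"
  using flat_smap_shift[of h x s] assms by (simp add: morph_def)

lemma length_morph_ge:
  assumes "\<And>c. h c \<noteq> []"
  shows "length x \<le> length (morph h x)"
proof (induction x)
  case (Cons a x)
  have "Suc 0 \<le> length (h a)" using assms[of a] by (simp add: Suc_le_eq)
  with Cons show ?case by simp
qed simp

text \<open>Induction on prefixes: as \<open>h a\<close> has at least two letters and no image is
  empty, the image of the prefix of length \<open>n > 0\<close> covers the prefix of length
  \<open>n + 1\<close>.\<close>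

lemma sset_fixed_point_from:
  fixes h :: "'a \<Rightarrow> 'a list"
  assumes h: "\<And>c. h c \<noteq> []" "h a = a # v" "v \<noteq> []"
    and A: "a \<in> A" "\<And>c. c \<in> A \<Longrightarrow> set (h c) \<subseteq> A"
  shows "sset (fixed_point_from h a) \<subseteq> A"
proof -
  define t where "t = fixed_point_from h a"
  have hd: "shd t = a" and fl: "flat (smap h t) = t"
    using fixed_point_from[of h a v, OF h] by (simp_all add: t_def)
  have A_morph: "set (morph h x) \<subseteq> A" if "set x \<subseteq> A" for x
    using that A(2) by (fastforce simp: morph_def)
  have "set (stake n t) \<subseteq> A" for n
  proof (induction n)
    case (Suc n)
    show ?case
    proof (cases n)
      case 0
      then show ?thesis using hd A(1) by simp
    next
      case (Suc m)
      have "length (stake (Suc n) t) \<le> length (morph h (stake n t))"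
      proof -
        have "Suc 0 \<le> length v" using h(3) by (simp add: Suc_le_eq)
        moreover have "length (stake m (stl t)) \<le> length (morph h (stake m (stl t)))"
          by (rule length_morph_ge) (rule h(1))
        ultimately show ?thesis using Suc by (simp add: hd h(2))
      qed
      moreover have "t = morph h (stake n t) @- flat (smap h (sdrop n t))"
        by (metis flat_smap_morph[of h] h(1) fl stake_sdrop)
      ultimately have "stake (Suc n) t = take (Suc n) (morph h (stake n t))"
        by (metis length_stake stake_shift stake.simps(1) append_Nil2 diff_is_0_eq)
      then show ?thesis using A_morph[OF Suc.IH] set_take_subset by fastforce
    qed
  qed simp
  then have "t !! n \<in> A" for n
    using stake_nth[of n "Suc n" t] nth_mem[of n "stake (Suc n) t"]
    by (metis length_stake lessI subsetD)
  then show ?thesis unfolding t_def[symmetric] by (auto simp: sset_range)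
qed


section \<open>Sequences generated by 2-uniform morphisms\<close>

text \<open>Here \<open>P\<close> is meant to list the two-letter factors. Offsets below
  \<open>2 ^ k\<close> suffice, since a later start falls into the block of the next letter.\<close>

definition coded_windows ::
  "('a \<Rightarrow> 'a list) \<Rightarrow> ('a \<Rightarrow> 'b) \<Rightarrow> nat \<Rightarrow> nat \<Rightarrow> 'a list list \<Rightarrow> 'b list list" where
  "coded_windows h c k L P = remdups (map (map c) (concat
     (map (\<lambda>p. map (\<lambda>r. take L (drop r ((morph h ^^ k) p))) [0..<2 ^ k]) P)))"

text \<open>Every factor of a stream extends to the right, so prefixes of the words of length
  \<open>L\<close> give all shorter factors; one list \<open>W\<close> serves for all
  lengths.\<close>

definition trapezoidal_counts :: "nat \<Rightarrow> 'a list list \<Rightarrow> nat list" where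
  "trapezoidal_counts L W =
     map (\<lambda>n. length (filter trapezoidal (remdups (map (take n) W)))) [0..<Suc L]"

text \<open>The letterwise form constrains \<open>h\<close> only on letters that occur, and it can
  be checked directly for paperfolding, which is given by a recurrence.\<close>

locale two_uniform =
  fixes h :: "'a \<Rightarrow> 'a list" and t :: "'a stream"
  assumes block: "h (t !! j) = [t !! (2 * j), t !! (2 * j + 1)]"
begin

lemma morph_stake: "morph h (stake m (sdrop j t)) = stake (2 * m) (sdrop (2 * j) t)"
proof (induction m arbitrary: j)
  case (Suc m)
  have "sdrop (2 * j) t = t !! (2 * j) ## t !! (2 * j + 1) ## sdrop (2 * Suc j) t"
    by (metis Suc_eq_plus1 add_2_eq_Suc' mult_Suc_right sdrop_simps(1,2) stream.collapse add.commute)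
  then show ?case using Suc[of "Suc j"] by (simp add: block)
qed simp

lemma morph_funpow_stake:
  "(morph h ^^ k) (stake m (sdrop j t)) = stake (2 ^ k * m) (sdrop (2 ^ k * j) t)"
  by (induction k) (simp_all add: morph_stake mult.assoc)

text \<open>The bounds give \<open>r + L \<le> 2 * 2 ^ k\<close>, the length of the image of two
  letters, so the window does not run over its end.\<close>

lemma factor_morph_funpow:
  assumes "L \<le> 2 ^ k + 1" "r < 2 ^ k"
  shows "stake L (sdrop (2 ^ k * j + r) t) =
    take L (drop r ((morph h ^^ k) (stake 2 (sdrop j t))))"
  using assms by (simp add: morph_funpow_stake drop_stake take_stake sdrop_add min_def add.commute)

text \<open>Each pair in \<open>P\<close> occurs in the prefix \<open>h^m (shd t)\<close> of
  \<open>t\<close>. Conversely, \<open>P\<close> contains the first pair and is closed under taking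
  the pairs at offsets 0 and 1 of an image, which reaches every position.\<close>

lemma two_letter_factors:
  assumes sub: "\<And>p. p \<in> set P \<Longrightarrow> sublist p ((morph h ^^ m) [shd t])"
    and len: "\<And>p. p \<in> set P \<Longrightarrow> length p = 2"
    and start: "h (shd t) \<in> set P"
    and closed: "\<And>p. p \<in> set P \<Longrightarrow> take 2 (morph h p) \<in> set P \<and> take 2 (drop 1 (morph h p)) \<in> set P"
  shows "range (\<lambda>j. stake 2 (sdrop j t)) = set P"
proof
  have "stake 2 (sdrop i t) \<in> set P" for i
  proof (induction i rule: less_induct)
    case (less i)
    show ?case
    proof (cases "i = 0")
      case True
      then show ?thesis using start block[of 0] by (simp add: numeral_2_eq_2)
    next
      case False
      \<comment> \<open>The pair at \<open>2 * j + r\<close> is the window at offset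
        \<open>r\<close> in the image of the pair at \<open>j\<close>, and
        \<open>j < i\<close>.\<close>
      define j r where "j = i div 2" and "r = i mod 2"
      have i: "i = 2 ^ 1 * j + r" and r: "r < 2 ^ 1" by (simp_all add: j_def r_def)
      have "j < i" using False by (simp add: j_def)
      from closed[OF less[OF this]] have "take 2 (drop r (morph h (stake 2 (sdrop j t)))) \<in> set P"
        using r by (cases r) auto
      then show ?thesis unfolding i by (subst factor_morph_funpow) (use r in auto)
    qed
  qed
  then show "range (\<lambda>j. stake 2 (sdrop j t)) \<subseteq> set P" by blast
next
  show "set P \<subseteq> range (\<lambda>j. stake 2 (sdrop j t))"
  proof
    fix p assume p: "p \<in> set P"
    have "(morph h ^^ m) [shd t] = stake (2 ^ m) t"
      using morph_funpow_stake[of m 1 0] by simp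
    then have "(morph h ^^ m) [shd t] \<in> factors t"
      unfolding factors_def by (metis (mono_tags, lifting) CollectI sdrop.simps(1))
    from factors_sublist[OF this sub[OF p]] len[OF p] show "p \<in> range (\<lambda>j. stake 2 (sdrop j t))"
      using factors_length[of t 2] by blast
  qed
qed

text \<open>Division by \<open>2 ^ k\<close> writes each position as \<open>2 ^ k * j + r\<close>;
  the window there depends only on \<open>r\<close> and the pair at \<open>j\<close>.\<close>

lemma factors_length_coded:
  assumes P: "range (\<lambda>j. stake 2 (sdrop j t)) = set P" and L: "L \<le> 2 ^ k + 1"
  shows "{x \<in> factors (smap c t). length x = L} = set (coded_windows h c k L P)"
proof -
  have "set (coded_windows h c k L P) =
      map c ` (\<Union>p\<in>set P. (\<lambda>r. take L (drop r ((morph h ^^ k) p))) ` {..<2 ^ k})"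
    by (simp add: coded_windows_def lessThan_atLeast0)
  also have "\<dots> = map c ` (\<Union>j. (\<lambda>r. stake L (sdrop (2 ^ k * j + r) t)) ` {..<2 ^ k})"
    unfolding P[symmetric] by (simp add: factor_morph_funpow[OF L])
  also have "(\<Union>j. (\<lambda>r. stake L (sdrop (2 ^ k * j + r) t)) ` {..<2 ^ k}) =
      range (\<lambda>i. stake L (sdrop i t))"
  proof (intro equalityI subsetI)
    fix x assume "x \<in> range (\<lambda>i. stake L (sdrop i t))"
    then obtain i where i: "x = stake L (sdrop i t)" by blast
    have "i = 2 ^ k * (i div 2 ^ k) + i mod 2 ^ k \<and> i mod 2 ^ k < 2 ^ k" by simp
    with i show "x \<in> (\<Union>j. (\<lambda>r. stake L (sdrop (2 ^ k * j + r) t)) ` {..<2 ^ k})"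
      by (intro UN_I[of "i div 2 ^ k"] image_eqI[of _ _ "i mod 2 ^ k"]) simp_all
  qed blast
  finally show ?thesis unfolding factors_length by (simp add: image_image)
qed

theorem trapezoidal_factors_coded:
  assumes P: "range (\<lambda>j. stake 2 (sdrop j t)) = set P" and L: "L \<le> 2 ^ k + 1"
    and counts: "trapezoidal_counts L (coded_windows h c k L P) = ns @ [0]"
    and ns: "ns \<noteq> []" "last ns \<noteq> 0"
  shows "card (trapezoidal_factors (smap c t)) = sum_list ns"
    and "Max (length ` trapezoidal_factors (smap c t)) = length ns - 1"
proof -
  let ?s = "smap c t" and ?W = "coded_windows h c k L P"
  have F: "{x \<in> factors ?s. length x = n} = set (map (take n) ?W)" if "n \<le> L" for n
  proof -
    have "stake n (sdrop i ?s) = take n (stake L (sdrop i ?s))" for i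
      using that by (simp add: take_map take_stake min_def)
    then have "{x \<in> factors ?s. length x = n} = take n ` {x \<in> factors ?s. length x = L}"
      unfolding factors_length image_image by metis
    then show ?thesis by (simp add: factors_length_coded[OF P L])
  qed
  have "card {x \<in> trapezoidal_factors ?s. length x = n} =
      length (filter trapezoidal (remdups (map (take n) ?W)))" if "n \<le> L" for n
  proof -
    have "{x \<in> trapezoidal_factors ?s. length x = n} =
        {x \<in> {x \<in> factors ?s. length x = n}. trapezoidal x}"
      by (auto simp: trapezoidal_factors_def)
    also have "\<dots> = set (filter trapezoidal (remdups (map (take n) ?W)))"
      using F[OF that] by auto
    finally show ?thesis by (metis distinct_card distinct_filter distinct_remdups)
  qed
  then have *: "map (\<lambda>n. card {x \<in> trapezoidal_factors ?s. length x = n}) [0..<Suc L] = ns @ [0]"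
    unfolding counts[symmetric] trapezoidal_counts_def by (intro map_cong) auto
  have fin: "finite {x \<in> factors ?s. length x = n}" if "n \<le> L" for n
    by (subst F[OF that]) simp
  show "card (trapezoidal_factors ?s) = sum_list ns"
    and "Max (length ` trapezoidal_factors ?s) = length ns - 1"
    using card_Max_trapezoidal_factors[OF * ns fin] by blast+
qed

end

text \<open>Dropping one letter of the preimage drops a block of two letters of the image. The
  length is required only on \<open>sset t\<close>, as letters outside the alphabet may have other
  images.\<close>

lemma two_uniform_flat:
  assumes fl: "flat (smap h t) = t" and len: "\<And>c. c \<in> sset t \<Longrightarrow> length (h c) = 2"
  shows "two_uniform h t"
proof
  fix j
  have h: "length (h (t !! j)) = 2" for j using len[of "t !! j"] by simp
  have unf: "flat (smap h (sdrop j t)) = h (t !! j) @- flat (smap h (sdrop (Suc j) t))" for j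
    using h[of j] by (subst flat_unfold) (auto simp: sdrop_simps)
  have "sdrop (2 * j) t = flat (smap h (sdrop j t))" for j
  proof (induction j)
    case (Suc j)
    have "sdrop (2 * Suc j) t = sdrop 2 (sdrop (2 * j) t)" by (simp add: sdrop_add)
    also have "\<dots> = flat (smap h (sdrop (Suc j) t))"
      unfolding Suc unf[of j] using h[of j] by (simp add: sdrop_shift)
    finally show ?case .
  qed (simp add: fl)
  moreover have "stake 2 (flat (smap h (sdrop j t))) = h (t !! j)"
    by (subst unf) (simp add: stake_shift h)
  ultimately have "stake 2 (sdrop (2 * j) t) = h (t !! j)" by simp
  then show "h (t !! j) = [t !! (2 * j), t !! (2 * j + 1)]"
    by (simp add: numeral_2_eq_2 sdrop_simps)
qed

lemma two_uniform_fixed_point_from: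
  assumes h: "\<And>c. h c \<noteq> []" "h a = [a, b]"
    and A: "a \<in> A" "\<And>c. c \<in> A \<Longrightarrow> set (h c) \<subseteq> A \<and> length (h c) = 2"
  shows "two_uniform h (fixed_point_from h a)"
proof (rule two_uniform_flat)
  show "flat (smap h (fixed_point_from h a)) = fixed_point_from h a"
    using fixed_point_from(2)[of h a "[b]"] h by simp
  show "length (h c) = 2" if "c \<in> sset (fixed_point_from h a)" for c
    using sset_fixed_point_from[of h a "[b]" A] h A that by blast
qed


section \<open>Thue-Morse, Rudin-Shapiro, paperfolding and period-doubling\<close>

lemma card_Max_thue_morse:
  shows "card (trapezoidal_factors thue_morse) = 43"
    and "Max (length ` trapezoidal_factors thue_morse) = 8"
proof -
  \<comment> \<open>The orbit of \<open>?h 0 = [0, 1]\<close> under passing to the pairs at offsets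
    0 and 1 of an image.\<close>
  let ?P = "[[0, 1], [1, 1], [1, 0], [0, 0]] :: nat list list"
  let ?h = thue_morse_morphism
  interpret two_uniform ?h thue_morse
    unfolding thue_morse_def
    by (rule two_uniform_fixed_point_from[where A = "{0, 1}" and b = 1])
      (auto simp: thue_morse_morphism_def)
  have "shd thue_morse = 0"
    unfolding thue_morse_def
    by (rule fixed_point_from[where v = "[1]"]) (auto simp: thue_morse_morphism_def)
  then have P: "range (\<lambda>j. stake 2 (sdrop j thue_morse)) = set ?P"
  \<comment> \<open>The third iterate, 01101001, already contains all four pairs.\<close>
  proof (intro two_letter_factors[where m = 3], unfold \<open>shd thue_morse = 0\<close>)
    have "\<forall>p\<in>set ?P. sublist p ((morph ?h ^^ 3) [0])" by code_simp
    then show "sublist p ((morph ?h ^^ 3) [0])" if "p \<in> set ?P" for p using that by blast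
  qed (auto simp: thue_morse_morphism_def)
  \<comment> \<open>The value 9 is the first length without trapezoidal factors, and
    \<open>9 = 2 ^ 3 + 1\<close> is just covered by \<open>k = 3\<close>.\<close>
  have "trapezoidal_counts 9 (coded_windows ?h id 3 9 ?P) = [1, 2, 4, 6, 10, 8, 6, 4, 2] @ [0]"
    by code_simp
  from trapezoidal_factors_coded[OF P _ this]
  show "card (trapezoidal_factors thue_morse) = 43"
    and "Max (length ` trapezoidal_factors thue_morse) = 8"
    by (simp_all add: stream.map_id)
qed

lemma card_Max_rudin_shapiro:
  shows "card (trapezoidal_factors rudin_shapiro) = 185"
    and "Max (length ` trapezoidal_factors rudin_shapiro) = 12"
proof -
  let ?P = "[[0, 1], [1, 0], [0, 2], [2, 0], [1, 3], [3, 1], [2, 3], [3, 2]] :: nat list list"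
  let ?h = rudin_shapiro_morphism
  define t where "t = fixed_point_from ?h 0"
  interpret two_uniform ?h t
    unfolding t_def
    by (rule two_uniform_fixed_point_from[where A = "{0, 1, 2, 3}" and b = 1])
      (auto simp: rudin_shapiro_morphism_def)
  have "shd t = 0"
    unfolding t_def
    by (rule fixed_point_from[where v = "[1]"]) (auto simp: rudin_shapiro_morphism_def)
  then have P: "range (\<lambda>j. stake 2 (sdrop j t)) = set ?P"
  proof (intro two_letter_factors[where m = 5], unfold \<open>shd t = 0\<close>)
    have "\<forall>p\<in>set ?P. sublist p ((morph ?h ^^ 5) [0])" by code_simp
    then show "sublist p ((morph ?h ^^ 5) [0])" if "p \<in> set ?P" for p using that by blast
  qed (auto simp: rudin_shapiro_morphism_def)
  \<comment> \<open>Length 13 exceeds \<open>2 ^ 3 + 1\<close>, hence \<open>k = 4\<close>. The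
    pairs in \<open>?P\<close> are uncoded; the coding is applied to the windows only.\<close>
  have "trapezoidal_counts 13 (coded_windows ?h (\<lambda>c. c div 2) 4 13 ?P) =
      [1, 2, 4, 8, 16, 24, 30, 26, 26, 20, 16, 8, 4] @ [0]"
    by code_simp
  from trapezoidal_factors_coded[OF P _ this]
  show "card (trapezoidal_factors rudin_shapiro) = 185"
    and "Max (length ` trapezoidal_factors rudin_shapiro) = 12"
    by (simp_all add: rudin_shapiro_def t_def[symmetric])
qed

text \<open>The letter \<open>2 * (n mod 2) + p\<^sub>n\<close> determines \<open>p\<^sub>2\<^sub>n\<close> and \<open>p\<^sub>2\<^sub>n\<^sub>+\<^sub>1\<close>,
  so the paperfolding sequence is a coding of a sequence generated by a 2-uniform morphism.\<close>

definition paperfolding_morphism :: "nat \<Rightarrow> nat list" where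
  "paperfolding_morphism c = [c div 2, 2 + c mod 2]"

lemma paperfolding_term_double: "paperfolding_term (2 * n) = n mod 2"
proof -
  have "n = 2 * (n div 2) \<and> n mod 2 = 0 \<or> n = 2 * (n div 2) + 1 \<and> n mod 2 = 1" by presburger
  then show ?thesis
  proof
    assume *: "n = 2 * (n div 2) \<and> n mod 2 = 0"
    then have "2 * n = 4 * (n div 2)" by presburger
    then show ?thesis using * by (simp only: paperfolding_term.simps)
  next
    assume *: "n = 2 * (n div 2) + 1 \<and> n mod 2 = 1"
    then have "2 * n = 4 * (n div 2) + 2" by presburger
    then show ?thesis using * by (simp only: paperfolding_term.simps)
  qed
qed

lemma paperfolding_term_less: "paperfolding_term n < 2"
  by (induction n rule: paperfolding_term.induct) (simp_all only: paperfolding_term.simps)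

lemma card_Max_paperfolding:
  shows "card (trapezoidal_factors paperfolding) = 57"
    and "Max (length ` trapezoidal_factors paperfolding) = 8"
proof -
  let ?P = "[[0, 2], [2, 1], [1, 2], [2, 0], [0, 3], [3, 1], [1, 3], [3, 0]] :: nat list list"
  let ?h = paperfolding_morphism
  define t where "t = smap (\<lambda>n. 2 * (n mod 2) + paperfolding_term n) nats"
  have t: "t !! n = 2 * (n mod 2) + paperfolding_term n" for n by (simp add: t_def)
  interpret two_uniform ?h t
  proof
    show "?h (t !! j) = [t !! (2 * j), t !! (2 * j + 1)]" for j
    proof -
      have "t !! (2 * j) = j mod 2" unfolding t paperfolding_term_double by simp
      moreover have "t !! (2 * j + 1) = 2 + paperfolding_term j"
        unfolding t paperfolding_term.simps by simp
      ultimately show ?thesis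
        using paperfolding_term_less[of j] by (simp add: t paperfolding_morphism_def)
    qed
  qed
  have "shd t = 0" using t[of 0] paperfolding_term_double[of 0] by simp
  then have P: "range (\<lambda>j. stake 2 (sdrop j t)) = set ?P"
  proof (intro two_letter_factors[where m = 5], unfold \<open>shd t = 0\<close>)
    have "\<forall>p\<in>set ?P. sublist p ((morph ?h ^^ 5) [0])" by code_simp
    then show "sublist p ((morph ?h ^^ 5) [0])" if "p \<in> set ?P" for p using that by blast
  qed (auto simp: paperfolding_morphism_def)
  \<comment> \<open>As paperfolding terms are below 2, reduction modulo 2 removes the parity part of
    the letter.\<close>
  have "paperfolding = smap (\<lambda>c. c mod 2) t"
    by (simp add: paperfolding_def t_def stream.map_comp o_def mod_less paperfolding_term_less)
  moreover have "trapezoidal_counts 9 (coded_windows ?h (\<lambda>c. c mod 2) 3 9 ?P) =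
      [1, 2, 4, 8, 12, 14, 8, 6, 2] @ [0]"
    by code_simp
  note trapezoidal_factors_coded[OF P _ this]
  ultimately show "card (trapezoidal_factors paperfolding) = 57"
    and "Max (length ` trapezoidal_factors paperfolding) = 8"
    by simp_all
qed

lemma card_Max_period_doubling:
  shows "card (trapezoidal_factors period_doubling) = 77"
    and "Max (length ` trapezoidal_factors period_doubling) = 15"
proof -
  let ?P = "[[1, 0], [0, 1], [1, 1]] :: nat list list"
  let ?h = period_doubling_morphism
  interpret two_uniform ?h period_doubling
    unfolding period_doubling_def
    by (rule two_uniform_fixed_point_from[where A = "{0, 1}" and b = 0])
      (auto simp: period_doubling_morphism_def)
  have "shd period_doubling = 1"
    unfolding period_doubling_def
    by (rule fixed_point_from[where v = "[0]"]) (auto simp: period_doubling_morphism_def)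
  then have P: "range (\<lambda>j. stake 2 (sdrop j period_doubling)) = set ?P"
  proof (intro two_letter_factors[where m = 3], unfold \<open>shd period_doubling = 1\<close>)
    have "\<forall>p\<in>set ?P. sublist p ((morph ?h ^^ 3) [1])" by code_simp
    then show "sublist p ((morph ?h ^^ 3) [1])" if "p \<in> set ?P" for p using that by blast
  qed (auto simp: period_doubling_morphism_def)
  have "trapezoidal_counts 16 (coded_windows ?h id 4 16 ?P) =
      [1, 2, 3, 5, 6, 8, 10, 9, 8, 7, 4, 4, 4, 3, 2, 1] @ [0]"
    by code_simp
  from trapezoidal_factors_coded[OF P _ this]
  show "card (trapezoidal_factors period_doubling) = 77"
    and "Max (length ` trapezoidal_factors period_doubling) = 15"
    by (simp_all add: stream.map_id)
qed


section \<open>The Fibonacci word\<close>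

abbreviation (input) \<phi> :: "nat \<Rightarrow> nat list" where
  "\<phi> \<equiv> fibonacci_morphism"

abbreviation (input) fib :: "nat stream" where
  "fib \<equiv> fibonacci_word"

lemma fibonacci_morphism_simps [simp]: "\<phi> 0 = [0, 1]" "\<phi> (Suc 0) = [0]" "\<phi> c \<noteq> []"
  by (simp_all add: fibonacci_morphism_def)

lemma fib_eq: "flat (smap \<phi> fib) = fib"
  unfolding fibonacci_word_def by (rule fixed_point_from(2)[where v = "[1]"]) auto

lemma sset_fib: "sset fib \<subseteq> {0, 1}"
  unfolding fibonacci_word_def by (rule sset_fixed_point_from[where v = "[1]"]) auto

section \<open>Block structure and desubstitution of images under \<open>\<phi>\<close>\<close>

lemma flat_smap_fibonacci_morphism:
  "flat (smap \<phi> (c ## s)) = \<phi> c @- flat (smap \<phi> s)"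
  by (subst flat_unfold) simp_all

lemma shd_flat_fibonacci:
  assumes "sset s \<subseteq> {0, 1}"
  shows "shd (flat (smap \<phi> s)) = 0"
  using assms by (cases s) (auto simp: flat_smap_fibonacci_morphism simp del: stream.map)

text \<open>A position of an image under \<open>\<phi>\<close> carrying the letter 0 starts a block; a position
  carrying 1 is the second position of a block \<open>\<phi> 0\<close>.\<close>

lemma fibonacci_cut:
  assumes "flat (smap \<phi> s) = x @- t" "sset s \<subseteq> {0, 1}"
  shows "(shd t = 0 \<and> (\<exists>w s'. s = w @- s' \<and> t = flat (smap \<phi> s'))) \<or>
         (shd t = 1 \<and> (\<exists>w s'. s = w @- 0 ## s' \<and> t = 1 ## flat (smap \<phi> s')))"
  using assms
proof (induction x arbitrary: s rule: length_induct)
  case (1 x)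
  obtain c s1 where s: "s = c ## s1" by (cases s)
  have fl: "\<phi> c @- flat (smap \<phi> s1) = x @- t"
    using "1.prems"(1) unfolding s flat_smap_fibonacci_morphism .
  have s1: "sset s1 \<subseteq> {0, 1}" and c: "c = 0 \<or> c = 1" using "1.prems"(2) s by auto
  show ?case
  \<comment> \<open>If the first block fits into \<open>x\<close>, it is stripped and induction
    applies. Otherwise \<open>x\<close> is empty, or it is the 0 of a block \<open>\<phi> 0\<close>
    cut in the middle.\<close>
  proof (cases "length (\<phi> c) \<le> length x")
    case True
    obtain y where y: "x = \<phi> c @ y" "flat (smap \<phi> s1) = y @- t"
    proof (rule that)
      have "stake (length (\<phi> c)) (x @- t) = \<phi> c" unfolding fl[symmetric] by (simp add: stake_shift)
      then have "take (length (\<phi> c)) x = \<phi> c" using True by (simp add: stake_shift)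
      then show x: "x = \<phi> c @ drop (length (\<phi> c)) x" by (metis append_take_drop_id)
      show "flat (smap \<phi> s1) = drop (length (\<phi> c)) x @- t"
        using fl by (subst (asm) x) (simp del: append_take_drop_id)
    qed
    have "length y < length x" using y by simp
    with 1 y s1 have "(shd t = 0 \<and> (\<exists>w s'. s1 = w @- s' \<and> t = flat (smap \<phi> s'))) \<or>
         (shd t = 1 \<and> (\<exists>w s'. s1 = w @- 0 ## s' \<and> t = 1 ## flat (smap \<phi> s')))" by blast
    then show ?thesis unfolding s by (metis shift.simps(2))
  next
    case False
    show ?thesis
    proof (cases x)
      case Nil
      then have "t = flat (smap \<phi> s)" using "1.prems"(1) by simp
      then show ?thesis using shd_flat_fibonacci "1.prems"(2) by (metis shift.simps(1))
    next
      case (Cons a y)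
      with False c have "c = 0" "y = []" by (auto simp: Suc_le_eq)
      with fl Cons have "t = 1 ## flat (smap \<phi> s1)" by simp
      then show ?thesis using s \<open>c = 0\<close> by (metis shift.simps(1) stream.sel(1))
    qed
  qed
qed

text \<open>One letter of look-ahead decides the block: a nonzero second letter means
  \<open>\<phi> 0\<close>, a zero means \<open>\<phi> 1\<close>. The letter \<open>a\<close> is not
  inspected, as it is 0 at the start of a block.\<close>

fun desubst :: "nat list \<Rightarrow> nat list" where
  "desubst (a # Suc b # u) = 0 # desubst u"
| "desubst (a # 0 # u) = 1 # desubst (0 # u)"
| "desubst _ = []"

lemma length_desubst: "u \<noteq> [] \<Longrightarrow> length (desubst u) < length u"
proof (induction u rule: desubst.induct)
  case (1 a b u)
  then show ?case by (cases u) auto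
qed auto

text \<open>If \<open>u\<close> ends in 0, it is not known whether this letter comes from \<open>\<phi> 0\<close> or \<open>\<phi> 1\<close>,
  and the desubstituted word stops before it.\<close>

lemma desubst:
  assumes "u @- y = flat (smap \<phi> s)" "sset s \<subseteq> {0, 1}"
  shows "(\<exists>z. s = desubst u @- z) \<and> (u = morph \<phi> (desubst u) \<or> u = morph \<phi> (desubst u) @ [0])"
  using assms
proof (induction u arbitrary: s rule: desubst.induct)
  case (1 a b u)
  obtain c s1 where s: "s = c ## s1" by (cases s)
  have fl: "a ## Suc b ## u @- y = \<phi> c @- flat (smap \<phi> s1)"
    using "1.prems"(1) unfolding s flat_smap_fibonacci_morphism by simp
  have s1: "sset s1 \<subseteq> {0, 1}" using "1.prems"(2) s by auto
  \<comment> \<open>After a block \<open>\<phi> 1\<close> the next letter would start a block and be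
    0, not \<open>Suc b\<close>.\<close>
  have "c = 0"
  proof (rule ccontr)
    assume "c \<noteq> 0"
    then have "c = Suc 0" using "1.prems"(2) s by auto
    with fl have "Suc b ## u @- y = flat (smap \<phi> s1)" by simp
    then show False using shd_flat_fibonacci[OF s1] by (metis stream.sel(1) nat.distinct(1))
  qed
  with fl have ab: "a = 0" "b = 0" and fl1: "u @- y = flat (smap \<phi> s1)" by auto
  from "1.IH"[OF fl1 s1] show ?case unfolding s using ab \<open>c = 0\<close> by auto
next
  case (2 a u)
  obtain c s1 where s: "s = c ## s1" by (cases s)
  have fl: "a ## 0 ## u @- y = \<phi> c @- flat (smap \<phi> s1)"
    using "2.prems"(1) unfolding s flat_smap_fibonacci_morphism by simp
  have s1: "sset s1 \<subseteq> {0, 1}" using "2.prems"(2) s by auto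
  have "c = Suc 0" using "2.prems"(2) s fl by auto
  with fl have a: "a = 0" and fl1: "(0 # u) @- y = flat (smap \<phi> s1)" by auto
  from "2.IH"[OF fl1 s1] show ?case unfolding s using a \<open>c = Suc 0\<close> by auto
next
  case "3_1"
  then show ?case by simp
next
  case ("3_2" a)
  then have "a = 0" using shd_flat_fibonacci[of s] by (metis shift.simps(2) stream.sel(1))
  then show ?case by simp
qed

lemma sset_fib_shift:
  assumes "fib = w @- s"
  shows "sset s \<subseteq> {0, 1}"
  using sset_fib unfolding assms by auto

text \<open>Left special factors are prefixes: desubstitution yields a shorter left special factor.\<close>

lemma left_special_prefix:
  assumes "0 # u \<in> factors fib" "1 # u \<in> factors fib"
  shows "\<exists>z. fib = u @- z"
  using assms
proof (induction u rule: length_induct)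
  case (1 u)
  show ?case
  proof (cases "u = []")
    case False
    obtain x y where "fib = x @- (1 # u) @- y" using "1.prems"(2) factors_iff_shift by blast
    then have xy: "flat (smap \<phi> fib) = x @- 1 ## u @- y" by (simp add: fib_eq)
    \<comment> \<open>The 1 before \<open>u\<close> closes a block \<open>\<phi> 0\<close>, so
      \<open>u\<close> starts at a block boundary and its preimage is preceded by 0.\<close>
    from fibonacci_cut[OF xy sset_fib] obtain w s where ws: "fib = w @- 0 ## s"
      and us: "u @- y = flat (smap \<phi> s)" by auto
    have s: "sset s \<subseteq> {0, 1}" using sset_fib_shift[OF ws] by simp
    obtain z where z: "s = desubst u @- z"
      and u: "u = morph \<phi> (desubst u) \<or> u = morph \<phi> (desubst u) @ [0]"
      using desubst[OF us s] by blast
    have u0: "shd (u @- y) = 0" using shd_flat_fibonacci[OF s] us by simp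
    obtain x' y' where "fib = x' @- (0 # u) @- y'" using "1.prems"(1) factors_iff_shift by blast
    then have xy': "flat (smap \<phi> fib) = x' @- 0 ## u @- y'" by (simp add: fib_eq)
    from fibonacci_cut[OF xy' sset_fib] obtain w' s' where ws': "fib = w' @- s'"
      and us': "0 ## u @- y' = flat (smap \<phi> s')" by auto
    obtain c s2 where s': "s' = c ## s2" by (cases s')
    have c: "c = 0 \<or> c = Suc 0" and s2: "sset s2 \<subseteq> {0, 1}"
      using sset_fib_shift[OF ws'] s' by auto
    have fl: "0 ## u @- y' = \<phi> c @- flat (smap \<phi> s2)"
      using us' unfolding s' flat_smap_fibonacci_morphism .
    \<comment> \<open>The block begun by the 0 before \<open>u\<close> cannot be
      \<open>\<phi> 0\<close>, since \<open>u\<close> starts with 0. So it is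
      \<open>\<phi> 1\<close>, and here the preimage of \<open>u\<close> is preceded by 1.\<close>
    have "c \<noteq> 0"
    proof
      assume "c = 0"
      with fl have "u @- y' = 1 ## flat (smap \<phi> s2)" by simp
      with u0 False show False by (cases u) auto
    qed
    with c fl have "c = Suc 0" "u @- y' = flat (smap \<phi> s2)" by auto
    from desubst[OF this(2) s2] obtain z' where z': "s2 = desubst u @- z'" by blast
    have "0 # desubst u \<in> factors fib"
      unfolding factors_iff_shift using ws z by (intro exI[of _ w] exI[of _ z]) simp
    moreover have "1 # desubst u \<in> factors fib"
      unfolding factors_iff_shift using ws' s' z' \<open>c = Suc 0\<close>
      by (intro exI[of _ w'] exI[of _ z']) simp
    ultimately obtain r where r: "fib = desubst u @- r"
      using "1.IH" length_desubst[OF False] by blast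
    have "fib = morph \<phi> (desubst u) @- flat (smap \<phi> r)"
      by (metis fib_eq r flat_smap_morph[of \<phi>] fibonacci_morphism_simps(3))
    \<comment> \<open>A possible last 0 of \<open>u\<close>, dropped by \<open>desubst\<close>, is
      the first letter of the next block.\<close>
    moreover have "\<exists>q. flat (smap \<phi> r) = 0 ## q"
      using shd_flat_fibonacci[OF sset_fib_shift[OF r]] by (metis stream.collapse)
    ultimately show ?thesis using u by (metis shift.simps(1,2) shift_append)
  qed auto
qed

text \<open>Removing the first letter sorts the factors of length \<open>n + 1\<close> into
  \<open>A 0\<close> and \<open>A 1\<close>; words in both are left special.\<close>

lemma fib_complexity:
  "finite {u \<in> factors fib. length u = n} \<and> card {u \<in> factors fib. length u = n} \<le> n + 1"
proof (induction n)
  case 0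
  have "{u \<in> factors fib. length u = 0} = {[]}" unfolding factors_length by auto
  then show ?case by simp
next
  case (Suc n)
  let ?F = "\<lambda>n. {u \<in> factors fib. length u = n}"
  define A where "A c = {u. c # u \<in> factors fib \<and> length u = n}" for c
  have sub: "A c \<subseteq> ?F n" for c
    using factors_sublist[of "c # _" fib] sublist_Cons_right[of _ c] unfolding A_def by blast
  then have fin: "finite (A c)" for c using Suc finite_subset by blast
  have letters: "set u \<subseteq> {0, 1}" if "u \<in> factors fib" for u
  proof -
    from that obtain x y where "fib = x @- u @- y" unfolding factors_iff_shift by blast
    from sset_fib_shift[OF this] show ?thesis by simp
  qed
  have F_Suc: "?F (Suc n) = (#) 0 ` A 0 \<union> (#) 1 ` A 1"
  proof (intro equalityI subsetI)
    fix u assume "u \<in> ?F (Suc n)"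
    then obtain c v where u: "u = c # v" "u \<in> factors fib" "length v = n"
      by (auto simp: length_Suc_conv)
    with letters[OF u(2)] show "u \<in> (#) 0 ` A 0 \<union> (#) 1 ` A 1" by (auto simp: A_def)
  qed (auto simp: A_def)
  have "card (?F (Suc n)) \<le> card (A 0) + card (A 1)"
    using card_Un_le[of "(#) 0 ` A 0" "(#) 1 ` A 1"] by (simp add: F_Suc card_image)
  also have "\<dots> = card (A 0 \<union> A 1) + card (A 0 \<inter> A 1)" by (rule card_Un_Int[OF fin fin])
  also have "card (A 0 \<union> A 1) \<le> n + 1"
    using card_mono[of "?F n" "A 0 \<union> A 1"] sub Suc by (meson Un_least order_trans)
  also have "card (A 0 \<inter> A 1) \<le> 1"
  proof -
    \<comment> \<open>A left special factor is a prefix, and there is one prefix of each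
      length.\<close>
    have "A 0 \<inter> A 1 \<subseteq> {stake n fib}"
    proof
      fix u assume u: "u \<in> A 0 \<inter> A 1"
      then obtain z where "fib = u @- z" using left_special_prefix[of u] by (auto simp: A_def)
      moreover have "length u = n" using u by (simp add: A_def)
      moreover have "stake (length u) (u @- z) = u" for z :: "nat stream" by (simp add: stake_shift)
      ultimately show "u \<in> {stake n fib}" by (metis singletonI)
    qed
    from card_mono[OF _ this] show ?thesis by simp
  qed
  finally show ?case unfolding F_Suc using fin by simp
qed

lemma trapezoidal_fib:
  assumes "x \<in> factors fib"
  shows "trapezoidal x"
  unfolding trapezoidal_def
proof
  fix n
  have "card {u. sublist u x \<and> length u = n} \<le> card {u \<in> factors fib. length u = n}"
    using assms fib_complexity[of n] by (intro card_mono) (auto intro: factors_sublist)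
  then show "card {u. sublist u x \<and> length u = n} \<le> n + 1" using fib_complexity[of n] by simp
qed

theorem theorem11:
  shows "card (trapezoidal_factors thue_morse) = 43 \<and>
         Max (length ` trapezoidal_factors thue_morse) = 8 \<and>
         card (trapezoidal_factors rudin_shapiro) = 185 \<and>
         Max (length ` trapezoidal_factors rudin_shapiro) = 12 \<and>
         card (trapezoidal_factors paperfolding) = 57 \<and>
         Max (length ` trapezoidal_factors paperfolding) = 8 \<and>
         card (trapezoidal_factors period_doubling) = 77 \<and>
         Max (length ` trapezoidal_factors period_doubling) = 15 \<and>
         (\<forall>x \<in> factors fibonacci_word. trapezoidal x)"
  using card_Max_thue_morse card_Max_rudin_shapiro card_Max_paperfolding card_Max_period_doubling
    trapezoidal_fib
  by blast

end
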